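(* Let $A$ and $B$ be stable matching instances on the same set $\mathcal{W}=\{w_1,\dots,w_n\}$ of workers and the same set $\mathcal{F}=\{f_1,\dots,f_n\}$ of firms, and suppose $A$ and $B$ are $(1,n)$, i.e. every worker other than $w_1$ has the same preference list in $A$ as in $B$ (firms and $w_1$ may have arbitrary, possibly different, preferences in $A$ and $B$). Then $\mathcal{M}_A \cap \mathcal{M}_B$ is a sublattice of both $\mathcal{L}_A$ and $\mathcal{L}_B$.
   Context: A stable matching instance $I$ on workers $\mathcal{W}$ and firms $\mathcal{F}$ (with $|\mathcal{W}|=|\mathcal{F}|=n$) assigns to every agent a strict total order over the agents of the other side. For a perfect matching $M$, a pair $(w,f)\notin M$ is blocking under $I$ if $w$ prefers $f$ to $M(w)$ and $f$ prefers $w$ to $M(f)$ (both under $I$); $M$ is stable under $I$ if it has no blocking pair. $\mathcal{M}_I$ is the set of matchings stable under $I$, and $\mathcal{L}_I$ is the lattice on $\mathcal{M}_I$ ordered by $M\preceq_I M'$ iff every worker weakly prefers (under $I$) its $M$-partner to its $M'$-partner. The join $M\vee_I M'$ assigns every worker its less preferred (under $I$) partner among $M(w),M'(w)$, and the meet $M\wedge_I M'$ its more preferred one; both are stable under $I$. A subset $S\subseteq \mathcal{M}_I$ is a sublattice of $\mathcal{L}_I$ if it is closed under $\vee_I$ and $\wedge_I$. *)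

theory Defs
  imports Main
begin

text \<open>
  Preferences are strict relations: \<open>(x, y) \<in> r\<close> means that \<open>x\<close> is strictly preferred to \<open>y\<close>.
\<close>

record ('w, 'f) sm_instance =
  wpref :: "'w \<Rightarrow> 'f rel"
  fpref :: "'f \<Rightarrow> 'w rel"

text \<open>
  Requiring each relation to live on the opposite side makes equality of relations the same as
  equality of preference lists. The values of \<open>wpref\<close> outside \<open>W\<close> and of \<open>fpref\<close> outside \<open>F\<close>
  are unconstrained and never used.
\<close>

definition stable_matching_instance :: "'w set \<Rightarrow> 'f set \<Rightarrow> ('w, 'f) sm_instance \<Rightarrow> bool" where
  "stable_matching_instance W F I \<longleftrightarrow>
     (\<forall>w\<in>W. wpref I w \<subseteq> F \<times> F \<and> strict_linear_order_on F (wpref I w)) \<and>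
     (\<forall>f\<in>F. fpref I f \<subseteq> W \<times> W \<and> strict_linear_order_on W (fpref I f))"

definition perfect_matching :: "'w set \<Rightarrow> 'f set \<Rightarrow> ('w \<times> 'f) set \<Rightarrow> bool" where
  "perfect_matching W F M \<longleftrightarrow>
     M \<subseteq> W \<times> F \<and> (\<forall>w\<in>W. \<exists>!f. (w, f) \<in> M) \<and> (\<forall>f\<in>F. \<exists>!w. (w, f) \<in> M)"

definition firm_of :: "('w \<times> 'f) set \<Rightarrow> 'w \<Rightarrow> 'f" where
  "firm_of M w = (THE f. (w, f) \<in> M)"

definition worker_of :: "('w \<times> 'f) set \<Rightarrow> 'f \<Rightarrow> 'w" where
  "worker_of M f = (THE w. (w, f) \<in> M)"

definition blocking_pair :: "('w, 'f) sm_instance \<Rightarrow> ('w \<times> 'f) set \<Rightarrow> 'w \<Rightarrow> 'f \<Rightarrow> bool" where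
  "blocking_pair I M w f \<longleftrightarrow>
     (w, f) \<notin> M \<and> (f, firm_of M w) \<in> wpref I w \<and> (w, worker_of M f) \<in> fpref I f"

definition stable_matchings ::
  "'w set \<Rightarrow> 'f set \<Rightarrow> ('w, 'f) sm_instance \<Rightarrow> ('w \<times> 'f) set set" where
  "stable_matchings W F I =
     {M. perfect_matching W F M \<and> (\<forall>w\<in>W. \<forall>f\<in>F. \<not> blocking_pair I M w f)}"

definition matching_le ::
  "'w set \<Rightarrow> ('w, 'f) sm_instance \<Rightarrow> ('w \<times> 'f) set \<Rightarrow> ('w \<times> 'f) set \<Rightarrow> bool" where
  "matching_le W I M M' \<longleftrightarrow>
     (\<forall>w\<in>W. firm_of M w = firm_of M' w \<or> (firm_of M w, firm_of M' w) \<in> wpref I w)"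

definition less_preferred :: "('w, 'f) sm_instance \<Rightarrow> 'w \<Rightarrow> 'f \<Rightarrow> 'f \<Rightarrow> 'f" where
  "less_preferred I w f f' = (if (f, f') \<in> wpref I w then f' else f)"

definition more_preferred :: "('w, 'f) sm_instance \<Rightarrow> 'w \<Rightarrow> 'f \<Rightarrow> 'f \<Rightarrow> 'f" where
  "more_preferred I w f f' = (if (f, f') \<in> wpref I w then f else f')"

definition matching_join ::
  "'w set \<Rightarrow> ('w, 'f) sm_instance \<Rightarrow> ('w \<times> 'f) set \<Rightarrow> ('w \<times> 'f) set \<Rightarrow> ('w \<times> 'f) set" where
  "matching_join W I M M' = {(w, less_preferred I w (firm_of M w) (firm_of M' w)) | w. w \<in> W}"

definition matching_meet ::
  "'w set \<Rightarrow> ('w, 'f) sm_instance \<Rightarrow> ('w \<times> 'f) set \<Rightarrow> ('w \<times> 'f) set \<Rightarrow> ('w \<times> 'f) set" where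
  "matching_meet W I M M' = {(w, more_preferred I w (firm_of M w) (firm_of M' w)) | w. w \<in> W}"

definition is_sublattice ::
  "'w set \<Rightarrow> 'f set \<Rightarrow> ('w, 'f) sm_instance \<Rightarrow> ('w \<times> 'f) set set \<Rightarrow> bool" where
  "is_sublattice W F I S \<longleftrightarrow>
     S \<subseteq> stable_matchings W F I \<and>
     (\<forall>M\<in>S. \<forall>M'\<in>S. matching_join W I M M' \<in> S \<and> matching_meet W I M M' \<in> S)"

text \<open>
  The two operations are the binary supremum and infimum for \<open>matching_le\<close>, in which the
  smaller matching is the one that the workers prefer.
\<close>

lemma firm_of_in:
  assumes "perfect_matching W F M" "w \<in> W"
  shows "firm_of M w \<in> F"
proof -
  have "\<exists>!f. (w, f) \<in> M" using assms unfolding perfect_matching_def by blast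
  then have "(w, firm_of M w) \<in> M" unfolding firm_of_def by (rule theI')
  then show ?thesis using assms unfolding perfect_matching_def by blast
qed

lemma firm_of_join:
  "w \<in> W \<Longrightarrow> firm_of (matching_join W I M M') w = less_preferred I w (firm_of M w) (firm_of M' w)"
  unfolding firm_of_def[of "matching_join W I M M'"] by (auto simp: matching_join_def)

lemma firm_of_meet:
  "w \<in> W \<Longrightarrow> firm_of (matching_meet W I M M') w = more_preferred I w (firm_of M w) (firm_of M' w)"
  unfolding firm_of_def[of "matching_meet W I M M'"] by (auto simp: matching_meet_def)

lemma
  assumes I: "stable_matching_instance W F I"
    and M: "perfect_matching W F M" and M': "perfect_matching W F M'"
  shows matching_join_upper1: "matching_le W I M (matching_join W I M M')"
    and matching_join_upper2: "matching_le W I M' (matching_join W I M M')"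
    and matching_join_least:
      "matching_le W I M N \<Longrightarrow> matching_le W I M' N \<Longrightarrow> matching_le W I (matching_join W I M M') N"
    and matching_meet_lower1: "matching_le W I (matching_meet W I M M') M"
    and matching_meet_lower2: "matching_le W I (matching_meet W I M M') M'"
    and matching_meet_greatest:
      "matching_le W I N M \<Longrightarrow> matching_le W I N M' \<Longrightarrow> matching_le W I N (matching_meet W I M M')"
proof -
  have tot: "firm_of M w = firm_of M' w \<or> (firm_of M w, firm_of M' w) \<in> wpref I w \<or>
      (firm_of M' w, firm_of M w) \<in> wpref I w" if "w \<in> W" for w
    using I firm_of_in[OF M that] firm_of_in[OF M' that] that
    unfolding stable_matching_instance_def strict_linear_order_on_def total_on_def by blast
  show "matching_le W I M (matching_join W I M M')" "matching_le W I M' (matching_join W I M M')"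
    "matching_le W I (matching_meet W I M M') M" "matching_le W I (matching_meet W I M M') M'"
    unfolding matching_le_def
    by (auto simp: firm_of_join firm_of_meet less_preferred_def more_preferred_def dest: tot)
  show "matching_le W I M N \<Longrightarrow> matching_le W I M' N \<Longrightarrow> matching_le W I (matching_join W I M M') N"
    "matching_le W I N M \<Longrightarrow> matching_le W I N M' \<Longrightarrow> matching_le W I N (matching_meet W I M M')"
    unfolding matching_le_def
    by (auto simp: firm_of_join firm_of_meet less_preferred_def more_preferred_def)
qed

end

theory Submission
  imports Defs
begin

text \<open>
  On the set \<open>S\<close> of workers who strictly prefer \<open>M\<close> to \<open>M'\<close>, stability gives \<open>M(S) \<subseteq> M'(S)\<close>,
  hence equality by counting; so the join and the meet, which swap the two matchings on \<open>S\<close>, are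
  perfect matchings, and their stability follows from that of \<open>M\<close> and \<open>M'\<close>. For instances \<open>A\<close> and
  \<open>B\<close> that differ only in the worker \<open>w\<^sub>1\<close> (and in the firms), the joins in \<open>A\<close> and in \<open>B\<close> of two
  matchings stable under both are perfect matchings that agree off \<open>w\<^sub>1\<close>, so they are equal; the
  same holds for the meets. Thus each operation lands in both sets of stable matchings.
\<close>

section \<open>Matchings represented as maps from workers to firms\<close>

definition graph_of :: "'w set \<Rightarrow> ('w \<Rightarrow> 'f) \<Rightarrow> ('w \<times> 'f) set" where
  "graph_of W m = {(x, m x) | x. x \<in> W}"

text \<open>Absence of blocking pairs, read on a map \<open>m\<close>: a firm is written as
  \<open>m y\<close>, with \<open>y\<close> the worker matched to it. This reaches every firm once
  \<open>m\<close> is onto and avoids inverting \<open>m\<close>.\<close>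

definition unblocked :: "'w set \<Rightarrow> ('w, 'f) sm_instance \<Rightarrow> ('w \<Rightarrow> 'f) \<Rightarrow> bool" where
  "unblocked W I m \<longleftrightarrow>
     (\<forall>x\<in>W. \<forall>y\<in>W. (m y, m x) \<in> wpref I x \<longrightarrow> (x, y) \<notin> fpref I (m y))"

lemma unblockedD:
  "unblocked W I m \<Longrightarrow> x \<in> W \<Longrightarrow> y \<in> W \<Longrightarrow> m y = z \<Longrightarrow> (z, m x) \<in> wpref I x \<Longrightarrow>
     (x, y) \<notin> fpref I z"
  by (auto simp: unblocked_def)

lemma firm_of_graph_of: "x \<in> W \<Longrightarrow> firm_of (graph_of W m) x = m x"
  by (auto simp: firm_of_def graph_of_def)

lemma worker_of_graph_of:
  assumes "inj_on m W" "x \<in> W"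
  shows "worker_of (graph_of W m) (m x) = x"
  unfolding worker_of_def graph_of_def
  by (rule the_equality) (use assms in \<open>auto dest: inj_onD\<close>)

lemma perfect_matching_graph_of:
  assumes "bij_betw m W F"
  shows "perfect_matching W F (graph_of W m)"
  unfolding perfect_matching_def
proof (intro conjI ballI)
  show "graph_of W m \<subseteq> W \<times> F"
    using assms by (auto simp: graph_of_def bij_betw_def)
  show "\<exists>!y. (x, y) \<in> graph_of W m" if "x \<in> W" for x
    using that by (auto simp: graph_of_def)
  show "\<exists>!x. (x, y) \<in> graph_of W m" if "y \<in> F" for y
  proof -
    obtain x where "x \<in> W" "y = m x" using assms \<open>y \<in> F\<close> unfolding bij_betw_def by blast
    then show ?thesis
      using bij_betw_imp_inj_on[OF assms] by (auto simp: graph_of_def dest: inj_onD)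
  qed
qed

lemma perfect_matchingD:
  assumes "perfect_matching W F M"
  shows "bij_betw (firm_of M) W F" and "M = graph_of W (firm_of M)"
proof -
  have mem: "(x, firm_of M x) \<in> M" if "x \<in> W" for x
    unfolding firm_of_def by (rule theI') (use assms that in \<open>auto simp: perfect_matching_def\<close>)
  have uniq: "y = firm_of M x" if "(x, y) \<in> M" for x y
    using assms that mem unfolding perfect_matching_def by blast
  show "M = graph_of W (firm_of M)"
    using mem uniq assms by (auto simp: graph_of_def perfect_matching_def)
  show "bij_betw (firm_of M) W F"
  proof (rule bij_betw_imageI)
    show "inj_on (firm_of M) W"
      using mem firm_of_in[OF assms] assms unfolding perfect_matching_def inj_on_def by metis
    show "firm_of M ` W = F"
      using uniq firm_of_in[OF assms] assms unfolding perfect_matching_def by blast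
  qed
qed

lemma stable_graph_of:
  assumes I: "stable_matching_instance W F I" and m: "bij_betw m W F"
  shows "graph_of W m \<in> stable_matchings W F I \<longleftrightarrow> unblocked W I m"
proof -
  have inj: "inj_on m W" and F: "F = m ` W"
    using m by (auto simp: bij_betw_def)
  have irr: "(m x, m x) \<notin> wpref I x" if "x \<in> W" for x
    using I that by (auto simp: stable_matching_instance_def strict_linear_order_on_def irrefl_def)
  have "blocking_pair I (graph_of W m) x (m y) \<longleftrightarrow>
      (m y, m x) \<in> wpref I x \<and> (x, y) \<in> fpref I (m y)" if "x \<in> W" "y \<in> W" for x y
  proof -
    have "(x, m y) \<in> graph_of W m \<longleftrightarrow> m y = m x"
      using that by (simp add: graph_of_def)
    then show ?thesis
      unfolding blocking_pair_def firm_of_graph_of[OF that(1)] worker_of_graph_of[OF inj that(2)]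
      using irr[OF that(1)] by metis
  qed
  then show ?thesis
    using perfect_matching_graph_of[OF m] unfolding stable_matchings_def unblocked_def F by auto
qed

lemma stable_matchingsE:
  assumes "stable_matching_instance W F I" "M \<in> stable_matchings W F I"
  shows "bij_betw (firm_of M) W F" and "unblocked W I (firm_of M)"
proof -
  have pm: "perfect_matching W F M"
    using assms(2) by (simp add: stable_matchings_def)
  show "bij_betw (firm_of M) W F" by (rule perfect_matchingD(1)[OF pm])
  from stable_graph_of[OF assms(1) this] show "unblocked W I (firm_of M)"
    using assms(2) perfect_matchingD(2)[OF pm] by simp
qed

section \<open>Two stable matchings of one instance: exchanging them on \<open>S\<close>\<close>

locale two_stable_matchings =
  fixes W :: "'w set" and F :: "'f set" and I :: "('w, 'f) sm_instance"
    and m m' :: "'w \<Rightarrow> 'f"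
  assumes fin: "finite W"
    and inst: "stable_matching_instance W F I"
    and m: "bij_betw m W F" and m': "bij_betw m' W F"
    and unblocked: "unblocked W I m" and unblocked': "unblocked W I m'"
begin

lemma in_F: "x \<in> W \<Longrightarrow> m x \<in> F" "x \<in> W \<Longrightarrow> m' x \<in> F"
  using m m' by (auto simp: bij_betw_def)

lemma wpref_irrefl: "x \<in> W \<Longrightarrow> (y, y) \<notin> wpref I x"
  using inst by (auto simp: stable_matching_instance_def strict_linear_order_on_def irrefl_def)

lemma wpref_trans: "x \<in> W \<Longrightarrow> (a, b) \<in> wpref I x \<Longrightarrow> (b, c) \<in> wpref I x \<Longrightarrow> (a, c) \<in> wpref I x"
  using inst unfolding stable_matching_instance_def strict_linear_order_on_def by (meson transD)

lemma wpref_total: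
  "x \<in> W \<Longrightarrow> m x = m' x \<or> (m x, m' x) \<in> wpref I x \<or> (m' x, m x) \<in> wpref I x"
  using inst in_F
  unfolding stable_matching_instance_def strict_linear_order_on_def total_on_def by blast

lemma fpref_trans: "y \<in> F \<Longrightarrow> (a, b) \<in> fpref I y \<Longrightarrow> (b, c) \<in> fpref I y \<Longrightarrow> (a, c) \<in> fpref I y"
  using inst unfolding stable_matching_instance_def strict_linear_order_on_def by (meson transD)

lemma fpref_total:
  "y \<in> F \<Longrightarrow> a \<in> W \<Longrightarrow> b \<in> W \<Longrightarrow> a \<noteq> b \<Longrightarrow> (a, b) \<in> fpref I y \<or> (b, a) \<in> fpref I y"
  using inst
  unfolding stable_matching_instance_def strict_linear_order_on_def total_on_def by blast

text \<open>The assumptions are symmetric; after the exchange, \<open>S\<close> becomes the set of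
  workers who strictly prefer \<open>m'\<close> to \<open>m\<close>.\<close>

lemma swap: "two_stable_matchings W F I m' m"
  by unfold_locales (fact fin inst m m' unblocked unblocked')+

definition S :: "'w set" where
  "S = {x \<in> W. (m x, m' x) \<in> wpref I x}"

text \<open>If the firm \<open>m x\<close> ranked \<open>x\<close> above its
  \<open>m'\<close>-partner \<open>y\<close>, then \<open>x\<close> and \<open>m x\<close> would
  block \<open>m'\<close>. Strict preference on \<open>S\<close> gives \<open>x \<noteq> y\<close>,
  so totality of the firm's order leaves only the opposite ranking.\<close>

lemma opposite_interests:
  assumes x: "x \<in> S" and y: "y \<in> W" and eq: "m' y = m x"
  shows "(y, x) \<in> fpref I (m x)"
proof -
  have xW: "x \<in> W" and p: "(m' y, m' x) \<in> wpref I x"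
    using x eq by (auto simp: S_def)
  then have "(x, y) \<notin> fpref I (m x)"
    using unblockedD[OF unblocked' xW y eq] eq by simp
  moreover have "x \<noteq> y" using p wpref_irrefl[OF xW] by auto
  ultimately show ?thesis using fpref_total[OF in_F(1)[OF xW] xW y] by blast
qed

lemma image_S: "m ` S = m' ` S"
proof (rule card_subset_eq)
  have sub: "S \<subseteq> W" by (auto simp: S_def)
  show "finite (m' ` S)" using finite_subset[OF sub fin] by simp
  have "inj_on m S" "inj_on m' S"
    using m m' sub by (auto simp: bij_betw_def intro: inj_on_subset)
  then show "card (m ` S) = card (m' ` S)" by (simp add: card_image)
  show "m ` S \<subseteq> m' ` S"
  proof
    fix z assume "z \<in> m ` S"
    then obtain x where x: "x \<in> S" "z = m x" by auto
    then have xW: "x \<in> W" using sub by auto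
    obtain y where y: "y \<in> W" "m' y = m x"
      using m' in_F(1)[OF xW] by (auto simp: bij_betw_def)
    \<comment> \<open>The firm \<open>m' y\<close> ranks \<open>y\<close> above its
      \<open>m\<close>-partner \<open>x\<close>, so \<open>y\<close> cannot prefer this firm to
      \<open>m y\<close>, or the two would block \<open>m\<close>.\<close>
    have ndir: "(m' y, m y) \<notin> wpref I y"
      using opposite_interests[OF x(1) y] unblocked xW y by (auto simp: unblocked_def)
    \<comment> \<open>Equality would make \<open>x\<close> and \<open>y\<close> share a firm under
      \<open>m\<close>, so \<open>y = x\<close> and \<open>m x = m' x\<close>, against
      \<open>x \<in> S\<close>.\<close>
    have "m y \<noteq> m' y"
    proof
      assume "m y = m' y"
      then have "y = x" using m xW y by (auto simp: bij_betw_def dest: inj_onD)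
      then show False using x y wpref_irrefl[OF xW] by (auto simp: S_def)
    qed
    then have "y \<in> S" using wpref_total[OF y(1)] ndir y(1) by (auto simp: S_def)
    then show "z \<in> m' ` S" using x y by (metis image_eqI)
  qed
qed

lemma bij_swap_on_S:
  "bij_betw (\<lambda>x. if x \<in> S then m x else m' x) W F" (is ?meet)
  "bij_betw (\<lambda>x. if x \<in> S then m' x else m x) W F" (is ?join)
proof -
  have sub: "S \<subseteq> W" by (auto simp: S_def)
  \<comment> \<open>The only collision to exclude is between \<open>g\<close> on \<open>S\<close>
    and \<open>h\<close> off \<open>S\<close>: since the images of \<open>S\<close> agree, each
    value of \<open>g\<close> on \<open>S\<close> is already taken by \<open>h\<close> on
    \<open>S\<close>.\<close>
  have bij: "bij_betw (\<lambda>x. if x \<in> S then g x else h x) W F"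
    if g: "bij_betw g W F" and h: "bij_betw h W F" and gh: "g ` S = h ` S" for g h :: "'w \<Rightarrow> 'f"
  proof (rule bij_betw_imageI)
    show "inj_on (\<lambda>x. if x \<in> S then g x else h x) W"
    proof (rule inj_onI)
      fix x y assume xy: "x \<in> W" "y \<in> W"
        and eq: "(if x \<in> S then g x else h x) = (if y \<in> S then g y else h y)"
      have gi: "\<And>a b. a \<in> W \<Longrightarrow> b \<in> W \<Longrightarrow> g a = g b \<Longrightarrow> a = b"
        and hi: "\<And>a b. a \<in> W \<Longrightarrow> b \<in> W \<Longrightarrow> h a = h b \<Longrightarrow> a = b"
        using g h by (auto simp: bij_betw_def dest: inj_onD)
      have "g a \<noteq> h b" if "a \<in> S" "b \<in> W" "b \<notin> S" for a b
      proof
        assume "g a = h b"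
        moreover have "g a \<in> g ` S" using that by simp
        ultimately obtain c where "c \<in> S" "h b = h c" using gh by auto
        then show False using hi[of b c] that sub by auto
      qed
      then have "x \<in> S \<Longrightarrow> y \<notin> S \<Longrightarrow> g x \<noteq> h y"
        and "y \<in> S \<Longrightarrow> x \<notin> S \<Longrightarrow> g y \<noteq> h x"
        using xy by blast+
      then show "x = y" using eq xy gi hi by (auto split: if_splits)
    qed
    have "(\<lambda>x. if x \<in> S then g x else h x) ` W = g ` S \<union> h ` (W - S)"
      using sub by auto
    also have "\<dots> = h ` W" using gh sub by auto
    finally show "(\<lambda>x. if x \<in> S then g x else h x) ` W = F"
      using h by (simp add: bij_betw_def)
  qed
  show ?meet by (rule bij[OF m m' image_S])
  show ?join by (rule bij[OF m' m image_S[symmetric]])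
qed

text \<open>Every worker gets the better of its two firms, so a firm that tempts \<open>x\<close>
  here tempts \<open>x\<close> in both matchings, in particular in the one that pairs this firm with
  \<open>y\<close>.\<close>

lemma unblocked_meet: "unblocked W I (\<lambda>x. if x \<in> S then m x else m' x)" (is "unblocked W I ?h")
  unfolding unblocked_def
proof (intro ballI impI)
  fix x y assume x: "x \<in> W" and y: "y \<in> W" and p: "(?h y, ?h x) \<in> wpref I x"
  have "(?h y, m x) \<in> wpref I x \<and> (?h y, m' x) \<in> wpref I x"
  proof (cases "x \<in> S")
    case True
    then show ?thesis using p wpref_trans[OF x, of "?h y" "m x" "m' x"] by (simp add: S_def)
  next
    case False
    then have "m x = m' x \<or> (m' x, m x) \<in> wpref I x"
      using wpref_total[OF x] x by (auto simp: S_def)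
    then show ?thesis using False p wpref_trans[OF x, of "?h y" "m' x" "m x"] by auto
  qed
  then show "(x, y) \<notin> fpref I (?h y)"
    using unblocked unblocked' x y by (auto simp: unblocked_def)
qed

text \<open>Every firm gets the better of its two workers. So if \<open>x\<close> and a firm blocked
  the join, the firm would also rank \<open>x\<close> above its partner in the matching that
  supplies the firm of \<open>x\<close>, and they would block that matching.\<close>

lemma unblocked_join: "unblocked W I (\<lambda>x. if x \<in> S then m' x else m x)" (is "unblocked W I ?k")
  unfolding unblocked_def
proof (intro ballI impI notI)
  fix x y assume x: "x \<in> W" and y: "y \<in> W"
    and p: "(?k y, ?k x) \<in> wpref I x" and q: "(x, y) \<in> fpref I (?k y)"
  have sub: "S \<subseteq> W" by (auto simp: S_def)
  interpret sw: two_stable_matchings W F I m' m by (rule swap)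
  \<comment> \<open>In the mixed cases \<open>u\<close> is the other partner of the firm of \<open>y\<close>, which ranks \<open>u\<close> weakly
    below \<open>y\<close>.\<close>
  show False
  proof (cases "x \<in> S \<longleftrightarrow> y \<in> S")
    case True
    then show False
      using p q x y unblocked unblocked' by (auto simp: unblocked_def split: if_splits)
  next
    case xy: False
    show False
    proof (cases "y \<in> S")
      case True
      then obtain u where u: "u \<in> S" "m u = m' y"
        using image_S by (metis imageE imageI)
      then have uW: "u \<in> W" using sub by auto
      have "(y, u) \<in> fpref I (m u)" by (rule opposite_interests[OF u(1) y u(2)[symmetric]])
      then have "(x, u) \<in> fpref I (m u)"
        using q True u(2) fpref_trans[OF in_F(1)[OF uW]] by simp
      then show False
        using unblockedD[OF unblocked x uW u(2)] p True xy u(2) by simp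
    next
      case False
      obtain u where u: "u \<in> W" "m' u = m y"
        using m' in_F(1)[OF y] by (auto simp: bij_betw_def)
      \<comment> \<open>Otherwise \<open>image_S\<close> gives the firm \<open>m y\<close> an
        \<open>m\<close>-partner in \<open>S\<close>, which can only be \<open>y\<close>.\<close>
      have uS: "u \<notin> S"
      proof
        assume "u \<in> S"
        then obtain v where "v \<in> S" "m v = m y" using u(2) image_S by (metis imageE imageI)
        then show False using m y False sub by (auto simp: bij_betw_def dest!: inj_onD)
      qed
      have "(x, u) \<in> fpref I (m' u)"
      proof (cases "m u = m' u")
        case True
        then have "u = y" using u m y by (auto simp: bij_betw_def dest: inj_onD)
        then show ?thesis using q False u(2) by simp
      next
        case ne: False
        \<comment> \<open>Off \<open>S\<close>, a worker with two different firms strictly prefers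
          \<open>m'\<close>, so the exchanged form of \<open>opposite_interests\<close> applies to
          \<open>u\<close>.\<close>
        then have "u \<in> sw.S" using wpref_total[OF u(1)] uS u(1) by (auto simp: S_def sw.S_def)
        then have "(y, u) \<in> fpref I (m' u)" using y u(2) by (intro sw.opposite_interests) simp_all
        then show ?thesis using q False u(2) fpref_trans[OF in_F(2)[OF u(1)]] by simp
      qed
      then show False
        using unblockedD[OF unblocked' x u] p False xy u(2) by simp
    qed
  qed
qed

end

theorem join_meet_stable:
  assumes "finite W" and I: "stable_matching_instance W F I"
    and "M \<in> stable_matchings W F I" "M' \<in> stable_matchings W F I"
  shows "matching_join W I M M' \<in> stable_matchings W F I"
    and "matching_meet W I M M' \<in> stable_matchings W F I"
proof -
  interpret two_stable_matchings W F I "firm_of M" "firm_of M'"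
    using assms stable_matchingsE by unfold_locales auto
  \<comment> \<open>Off \<open>S\<close>, ties included, \<open>less_preferred\<close> returns its
    first firm and \<open>more_preferred\<close> its second, exactly as in the else
    branches.\<close>
  have "matching_join W I M M' = graph_of W (\<lambda>x. if x \<in> S then firm_of M' x else firm_of M x)"
    by (auto simp: matching_join_def graph_of_def less_preferred_def S_def)
  then show "matching_join W I M M' \<in> stable_matchings W F I"
    using stable_graph_of[OF I bij_swap_on_S(2)] unblocked_join by simp
  have "matching_meet W I M M' = graph_of W (\<lambda>x. if x \<in> S then firm_of M x else firm_of M' x)"
    by (auto simp: matching_meet_def graph_of_def more_preferred_def S_def)
  then show "matching_meet W I M M' \<in> stable_matchings W F I"
    using stable_graph_of[OF I bij_swap_on_S(1)] unblocked_meet by simp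
qed

section \<open>Comparing the operations of the two instances\<close>

lemma perfect_matching_eqI:
  assumes M: "perfect_matching W F M" and N: "perfect_matching W F N"
    and eq: "\<And>x. x \<in> W - {a} \<Longrightarrow> firm_of M x = firm_of N x"
  shows "M = N"
proof -
  note bM = perfect_matchingD(1)[OF M] and bN = perfect_matchingD(1)[OF N]
  have "firm_of M x = firm_of N x" if x: "x \<in> W" for x
  proof (cases "x = a")
    case True
    obtain y where y: "y \<in> W" "firm_of M y = firm_of N x"
      using bM firm_of_in[OF N x] by (auto simp: bij_betw_def)
    \<comment> \<open>The firm that \<open>N\<close> gives to \<open>a\<close> belongs to some
      \<open>y\<close> under \<open>M\<close>; if \<open>y \<noteq> a\<close>, then \<open>N\<close>
      would give it to both \<open>y\<close> and \<open>a\<close>.\<close>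
    have "y = a"
    proof (rule ccontr)
      assume "y \<noteq> a"
      then have "firm_of N y = firm_of N x" using eq y by simp
      then show False
        using bN x y True \<open>y \<noteq> a\<close> by (auto simp: bij_betw_def dest: inj_onD)
    qed
    then show ?thesis using y True by simp
  qed (use eq x in simp)
  then have "graph_of W (firm_of M) = graph_of W (firm_of N)"
    by (auto simp: graph_of_def)
  then show ?thesis using perfect_matchingD(2)[OF M] perfect_matchingD(2)[OF N] by simp
qed

theorem theorem11:
  fixes n :: nat
    and w :: "nat \<Rightarrow> 'w" and f :: "nat \<Rightarrow> 'f"
    and W :: "'w set" and F :: "'f set"
    and A B :: "('w, 'f) sm_instance"
  assumes "n \<ge> 1"
    and "bij_betw w {1..n} W"
    and "bij_betw f {1..n} F"
    and "stable_matching_instance W F A"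
    and "stable_matching_instance W F B"
    and "\<forall>x\<in>W - {w 1}. wpref A x = wpref B x"
  shows "is_sublattice W F A (stable_matchings W F A \<inter> stable_matchings W F B)
       \<and> is_sublattice W F B (stable_matchings W F A \<inter> stable_matchings W F B)"
proof -
  \<comment> \<open>Finiteness feeds the counting argument in \<open>image_S\<close>.\<close>
  have fin: "finite W" using bij_betw_finite[OF assms(2)] by simp
  let ?S = "stable_matchings W F A \<inter> stable_matchings W F B"
  note stA = join_meet_stable[OF fin assms(4)] and stB = join_meet_stable[OF fin assms(5)]
  have pm: "perfect_matching W F M" if "M \<in> stable_matchings W F I" for M and I :: "('w, 'f) sm_instance"
    using that by (simp add: stable_matchings_def)
  have join: "matching_join W A M M' = matching_join W B M M'"
    and meet: "matching_meet W A M M' = matching_meet W B M M'"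
    if "M \<in> ?S" "M' \<in> ?S" for M M'
  proof -
    have "matching_join W A M M' \<in> stable_matchings W F A"
      "matching_join W B M M' \<in> stable_matchings W F B"
      "matching_meet W A M M' \<in> stable_matchings W F A"
      "matching_meet W B M M' \<in> stable_matchings W F B"
      using that stA stB by auto
    note pms = this[THEN pm]
    \<comment> \<open>The join is computed worker by worker from \<open>wpref\<close>, so the two
      joins can differ at most at \<open>w 1\<close>.\<close>
    show "matching_join W A M M' = matching_join W B M M'"
      by (rule perfect_matching_eqI[OF pms(1,2), of "w 1"])
        (use assms(6) in \<open>auto simp: firm_of_join less_preferred_def\<close>)
    show "matching_meet W A M M' = matching_meet W B M M'"
      by (rule perfect_matching_eqI[OF pms(3,4), of "w 1"])
        (use assms(6) in \<open>auto simp: firm_of_meet more_preferred_def\<close>)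
  qed
  have "matching_join W A M M' \<in> ?S \<and> matching_meet W A M M' \<in> ?S \<and>
      matching_join W B M M' \<in> ?S \<and> matching_meet W B M M' \<in> ?S"
    if "M \<in> ?S" "M' \<in> ?S" for M M'
    using that join[OF that] meet[OF that] stA[of M M'] stB[of M M'] by auto
  then show ?thesis unfolding is_sublattice_def by blast
qed

end
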